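(* Let $\gamma\geq 2$ be an integer and let $G=(V,E)$ be a strongly regular graph with parameters $(4\gamma+1,2\gamma,\gamma-1,\gamma)$ (a conference graph). Then the Lin--Lu--Yau curvature satisfies $\kappa(x,y)=\frac{1}{2}+\frac{1}{2\gamma}$ for all $xy\in E$.
   Context: Graphs are simple and undirected. A $d$-regular graph $G$ with $n$ vertices which is neither complete nor empty (i.e. has at least one edge) is called strongly regular with parameters $(n,d,\alpha,\beta)$ if any two adjacent vertices have exactly $\alpha$ common neighbors and any two distinct non-adjacent vertices have exactly $\beta$ common neighbors. Let $d(x,y)$ denote the combinatorial (shortest-path) distance in $G$. For two probability measures $\mu_1,\mu_2$ on $V$, the Wasserstein distance is $W_1(\mu_1,\mu_2)=\inf_{\pi}\sum_{y\in V}\sum_{x\in V}d(x,y)\pi(x,y)$, where the infimum is over all maps $\pi:V\times V\to[0,1]$ with $\mu_1(x)=\sum_{y\in V}\pi(x,y)$ for all $x\in V$ and $\mu_2(y)=\sum_{x\in V}\pi(x,y)$ for all $y\in V$. For $x\in V$ and $p\in[0,1]$, let $\mu_x^p$ be the probability measure with $\mu_x^p(x)=p$, $\mu_x^p(y)=\frac{1-p}{\deg(x)}$ if $xy\in E$, and $\mu_x^p(y)=0$ otherwise. The $p$-Ollivier curvature is $\kappa_p(x,y)=1-\frac{W_1(\mu_x^p,\mu_y^p)}{d(x,y)}$, and the Lin--Lu--Yau curvature is $\kappa(x,y)=\lim_{p\to1}\frac{\kappa_p(x,y)}{1-p}$ (limit over $p<1$). *)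

theory Defs
  imports "Graph_Theory.Graph_Theory"
begin

text \<open>
  A simple undirected graph is a finite symmetric loop-free digraph without parallel arcs
  (locale \<^locale>\<open>graph\<close>). Every undirected edge is a pair of opposite arcs, so the degree of a
  vertex is its \<^const>\<open>out_degree\<close>.
\<close>

definition common_neighbours :: "('a, 'b) pre_digraph \<Rightarrow> 'a \<Rightarrow> 'a \<Rightarrow> 'a set" where
  "common_neighbours G x y = {z \<in> verts G. x \<rightarrow>\<^bsub>G\<^esub> z \<and> y \<rightarrow>\<^bsub>G\<^esub> z}"

definition strongly_regular ::
  "('a, 'b) pre_digraph \<Rightarrow> nat \<Rightarrow> nat \<Rightarrow> nat \<Rightarrow> nat \<Rightarrow> bool" where
  "strongly_regular G n d \<alpha> \<beta> \<longleftrightarrow>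
     graph G \<and> card (verts G) = n \<and> (\<forall>x \<in> verts G. out_degree G x = d) \<and>
     \<not> complete_digraph n G \<and> arcs G \<noteq> {} \<and>
     (\<forall>x \<in> verts G. \<forall>y \<in> verts G. x \<rightarrow>\<^bsub>G\<^esub> y \<longrightarrow> card (common_neighbours G x y) = \<alpha>) \<and>
     (\<forall>x \<in> verts G. \<forall>y \<in> verts G. x \<noteq> y \<and> \<not> x \<rightarrow>\<^bsub>G\<^esub> y \<longrightarrow>
        card (common_neighbours G x y) = \<beta>)"

text \<open>
  The least number of arcs on a walk from \<open>x\<close> to \<open>y\<close>. The shortest-path cost is an extended real;
  the conversion sends the infinite distance between different components to 0. This does not affect
  the curvature of an edge: every plan transporting between measures supported in one component
  vanishes on all pairs of vertices at infinite distance.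
\<close>

definition graph_dist :: "('a, 'b) pre_digraph \<Rightarrow> 'a \<Rightarrow> 'a \<Rightarrow> real" where
  "graph_dist G x y = real_of_ereal (wf_digraph.\<mu> G (\<lambda>_. 1) x y)"

definition transport_plan ::
  "('a, 'b) pre_digraph \<Rightarrow> ('a \<Rightarrow> real) \<Rightarrow> ('a \<Rightarrow> real) \<Rightarrow> ('a \<Rightarrow> 'a \<Rightarrow> real) \<Rightarrow> bool" where
  "transport_plan G \<mu>1 \<mu>2 \<pi> \<longleftrightarrow>
     (\<forall>x \<in> verts G. \<forall>y \<in> verts G. 0 \<le> \<pi> x y \<and> \<pi> x y \<le> 1) \<and>
     (\<forall>x \<in> verts G. \<mu>1 x = (\<Sum>y \<in> verts G. \<pi> x y)) \<and>
     (\<forall>y \<in> verts G. \<mu>2 y = (\<Sum>x \<in> verts G. \<pi> x y))"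

text \<open>
  For probability measures the set of plans is nonempty and the costs are bounded below by 0, so the
  infimum in the reals is the true one.
\<close>

definition wasserstein ::
  "('a, 'b) pre_digraph \<Rightarrow> ('a \<Rightarrow> real) \<Rightarrow> ('a \<Rightarrow> real) \<Rightarrow> real" where
  "wasserstein G \<mu>1 \<mu>2 =
     (INF \<pi> \<in> {\<pi>. transport_plan G \<mu>1 \<mu>2 \<pi>}.
        \<Sum>y \<in> verts G. \<Sum>x \<in> verts G. graph_dist G x y * \<pi> x y)"

definition lazy_measure :: "('a, 'b) pre_digraph \<Rightarrow> real \<Rightarrow> 'a \<Rightarrow> 'a \<Rightarrow> real" where
  "lazy_measure G p x y =
     (if y = x then p
      else if x \<rightarrow>\<^bsub>G\<^esub> y then (1 - p) / real (out_degree G x)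
      else 0)"

definition ollivier_curvature :: "('a, 'b) pre_digraph \<Rightarrow> real \<Rightarrow> 'a \<Rightarrow> 'a \<Rightarrow> real" where
  "ollivier_curvature G p x y =
     1 - wasserstein G (lazy_measure G p x) (lazy_measure G p y) / graph_dist G x y"

definition lly_curvature :: "('a, 'b) pre_digraph \<Rightarrow> 'a \<Rightarrow> 'a \<Rightarrow> real" where
  "lly_curvature G x y = Lim (at_left 1) (\<lambda>p. ollivier_curvature G p x y / (1 - p))"

end

theory Submission
  imports Defs
begin

text \<open>
  Fix an edge \<open>xy\<close>. Besides \<open>x\<close> and \<open>y\<close>, the vertices fall into the \<open>\<gamma> - 1\<close> common neighbours
  \<open>D\<close> and three classes of \<open>\<gamma>\<close> vertices each: the neighbours \<open>P\<close> of \<open>x\<close> alone, the neighbours \<open>Q\<close>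
  of \<open>y\<close> alone, and the rest \<open>R\<close>. For \<open>p\<close> close to 1 and \<open>q = (1 - p) / (2 * \<gamma>)\<close> the two lazy
  measures agree except that an excess \<open>p - q\<close> must leave \<open>x\<close> and appear at \<open>y\<close>, and an excess \<open>q\<close>
  must leave each vertex of \<open>P\<close> and appear on each vertex of \<open>Q\<close>. No mass can move for less than its
  amount, so the Wasserstein distance is at least \<open>p - q + q * \<gamma>\<close>. A perfect matching between \<open>P\<close> and
  \<open>Q\<close> along edges attains this bound, and the bound gives the asserted curvature. The metric part of
  the argument is \<open>wasserstein_lazy_measures_matching\<close>; what remains is the existence of the
  matching, \<open>perfect_matching\<close>.

  By Hall's theorem, a failure yields a nonempty \<open>X \<subseteq> P\<close> of size \<open>s\<close> with fewer than \<open>s\<close> neighbours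
  in \<open>Q\<close>. Passing to the vertices of \<open>Q\<close> without neighbours in \<open>X\<close>, and reversing the edge, one may
  assume \<open>2 * s \<le> \<gamma> + 1\<close>. Such a set is excluded by \<open>no_hall_violator\<close>, in two ways.

  If \<open>s = 1\<close>, a vertex of \<open>P\<close> without neighbours in \<open>Q\<close> has neighbourhood \<open>{x} \<union> D \<union> R\<close>. Counting
  common neighbours then forces \<open>\<gamma>\<close> to be odd (seen from a vertex of \<open>Q\<close>) and even (seen from another
  vertex of \<open>P\<close>).

  If \<open>s \<ge> 2\<close>, let \<open>c z\<close> be the number of neighbours of \<open>z\<close> in \<open>X\<close>. Strong regularity determines
  \<open>\<Sum>z. (c z)\<^sup>2\<close> up to the number of edges inside \<open>X\<close>: it is about \<open>\<gamma> * s\<^sup>2\<close>, as for a random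
  set. On the other hand the sums of \<open>c\<close> over \<open>P\<close>, \<open>Q\<close>, \<open>D\<close> and \<open>R\<close> are all known in terms of the
  number \<open>K\<close> of edges between \<open>X\<close> and \<open>Q\<close>, and the \<open>K\<close> edges crowd onto fewer than \<open>s\<close> vertices
  of \<open>Q\<close>. Convexity of the square on each class makes \<open>\<Sum>z. (c z)\<^sup>2\<close> too large. The Cauchy-Schwarz
  inequality suffices for \<open>s \<ge> 3\<close> and \<open>\<gamma> \<ge> s + 3\<close>; in the cases \<open>s = 2\<close> and \<open>s = 3, \<gamma> = 5\<close> one needs
  in addition that \<open>c\<close> is integral.
\<close>

section \<open>Hall's marriage theorem\<close>

text \<open>
  The induction of Halmos and Vaughan. A proper nonempty subfamily that is tight (exactly as many
  candidates as members) can be matched first, and tightness is what keeps Hall's condition for the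
  others after all its candidates are removed. Without a tight subfamily every condition has slack
  one, so an arbitrary member can be given an arbitrary candidate.
\<close>
lemma hall_marriage:
  fixes N :: "'a \<Rightarrow> 'b set"
  assumes "finite A"
    and "\<And>a. a \<in> A \<Longrightarrow> finite (N a)"
    and "\<And>X. X \<subseteq> A \<Longrightarrow> card X \<le> card (\<Union>(N ` X))"
  shows "\<exists>f. inj_on f A \<and> (\<forall>a \<in> A. f a \<in> N a)"
  using assms
proof (induction "card A" arbitrary: A N rule: less_induct)
  case less
  note finA = less.prems(1) and finN = less.prems(2) and hall = less.prems(3)
  show ?case
  proof (cases "A = {}")
    case True
    then show ?thesis by simp
  next
    case False
    show ?thesis
    proof (cases "\<exists>X. X \<subset> A \<and> X \<noteq> {} \<and> card (\<Union>(N ` X)) = card X")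
      case True
      then obtain X where X: "X \<subset> A" "X \<noteq> {}" "card (\<Union>(N ` X)) = card X"
        by blast
      have finX: "finite X" using X(1) finA finite_subset by blast
      have "\<exists>f. inj_on f X \<and> (\<forall>a \<in> X. f a \<in> N a)"
      proof (rule less.hyps[OF _ finX])
        show "card X < card A" using X(1) finA by (simp add: psubset_card_mono)
        show "card Y \<le> card (\<Union>(N ` Y))" if "Y \<subseteq> X" for Y
          using that X(1) by (intro hall) blast
      qed (use finN X(1) in blast)
      then obtain f where f: "inj_on f X" "\<forall>a \<in> X. f a \<in> N a" by blast
      define M where "M a = N a - \<Union>(N ` X)" for a
      have "\<exists>g. inj_on g (A - X) \<and> (\<forall>a \<in> A - X. g a \<in> M a)"
      proof (rule less.hyps)
        show "card (A - X) < card A"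
          using X finA by (intro psubset_card_mono) auto
        show "finite (A - X)" using finA by simp
        show "finite (M a)" if "a \<in> A - X" for a
          using that finN by (simp add: M_def)
        show "card Y \<le> card (\<Union>(M ` Y))" if Y: "Y \<subseteq> A - X" for Y
        proof -
          have finY: "finite Y" using Y finA finite_subset by blast
          have fX: "finite (\<Union>(N ` X))" using finX finN X(1) by blast
          have fM: "finite (\<Union>(M ` Y))" using finY finN Y by (auto simp: M_def)
          have "card Y + card X = card (Y \<union> X)"
            using Y finX finY by (subst card_Un_disjoint) auto
          also have "\<dots> \<le> card (\<Union>(N ` (Y \<union> X)))"
            using Y X(1) by (intro hall) blast
          also have "\<Union>(N ` (Y \<union> X)) = \<Union>(M ` Y) \<union> \<Union>(N ` X)"
            by (auto simp: M_def)
          also have "card \<dots> = card (\<Union>(M ` Y)) + card (\<Union>(N ` X))"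
            using fX fM by (subst card_Un_disjoint) (auto simp: M_def)
          finally show ?thesis using X(3) by simp
        qed
      qed
      then obtain g where g: "inj_on g (A - X)" "\<forall>a \<in> A - X. g a \<in> M a" by blast
      define h where "h a = (if a \<in> X then f a else g a)" for a
      have "inj_on h A"
      proof (rule inj_onI)
        fix a b assume ab: "a \<in> A" "b \<in> A" "h a = h b"
        have sep: "f c \<noteq> g d" if "c \<in> X" "d \<in> A - X" for c d
          using that f(2) g(2) by (auto simp: M_def)
        show "a = b"
          using ab sep f(1) g(1) by (auto simp: h_def inj_on_def split: if_splits) metis+
      qed
      moreover have "\<forall>a \<in> A. h a \<in> N a"
        using f(2) g(2) by (auto simp: h_def M_def)
      ultimately show ?thesis by blast
    next
      case noTight: False
      obtain a where a: "a \<in> A" using False by blast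
      have "card {a} \<le> card (\<Union>(N ` {a}))" using a by (intro hall) simp
      then obtain b where b: "b \<in> N a"
        by (cases "N a = {}") auto
      define M where "M c = N c - {b}" for c
      have "\<exists>g. inj_on g (A - {a}) \<and> (\<forall>c \<in> A - {a}. g c \<in> M c)"
      proof (rule less.hyps)
        show "card (A - {a}) < card A" using a finA by (meson card_Diff1_less)
        show "finite (A - {a})" using finA by simp
        show "finite (M c)" if "c \<in> A - {a}" for c
          using that finN by (simp add: M_def)
        show "card Y \<le> card (\<Union>(M ` Y))" if Y: "Y \<subseteq> A - {a}" for Y
        proof (cases "Y = {}")
          case False
          have "Y \<subset> A" using Y a by blast
          then have "card Y < card (\<Union>(N ` Y))"
            using noTight False hall[of Y] by (metis le_neq_implies_less psubset_imp_subset)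
          moreover have "\<Union>(M ` Y) = \<Union>(N ` Y) - {b}" by (auto simp: M_def)
          ultimately show ?thesis
            by (auto simp: card_Diff_singleton_if)
        qed simp
      qed
      then obtain g where g: "inj_on g (A - {a})" "\<forall>c \<in> A - {a}. g c \<in> M c" by blast
      have "inj_on (g(a := b)) A"
        using g by (auto simp: inj_on_def M_def)
      moreover have "\<forall>c \<in> A. (g(a := b)) c \<in> N c"
        using g(2) b by (auto simp: M_def)
      ultimately show ?thesis by blast
    qed
  qed
qed

section \<open>Convexity of the square on a finite set\<close>

text \<open>
  For an integer \<open>k\<close> the product \<open>(k - m) * (k - (m + 1))\<close> is nonnegative. Hence on the integers the
  chord through \<open>m\<close> and \<open>m + 1\<close> supports the square from below, and it is sharper than any tangent
  when the mean value lies strictly between \<open>m\<close> and \<open>m + 1\<close>.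
\<close>
lemma sum_power2_ge_chord:
  fixes c :: "'a \<Rightarrow> int"
  shows "(2 * m + 1) * sum c A - m * (m + 1) * int (card A) \<le> (\<Sum>z\<in>A. (c z)\<^sup>2)"
proof -
  have chord: "(2 * m + 1) * k - m * (m + 1) \<le> k\<^sup>2" for k :: int
  proof -
    have "0 \<le> (k - m) * (k - (m + 1))"
      by (cases "k \<le> m") (auto intro: mult_nonpos_nonpos)
    then show ?thesis by (simp add: algebra_simps power2_eq_square)
  qed
  have "(\<Sum>z\<in>A. (2 * m + 1) * c z - m * (m + 1)) \<le> (\<Sum>z\<in>A. (c z)\<^sup>2)"
    by (intro sum_mono chord)
  also have "(\<Sum>z\<in>A. (2 * m + 1) * c z - m * (m + 1)) = (2 * m + 1) * sum c A - m * (m + 1) * int (card A)"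
    by (simp only: sum_subtractf sum_distrib_left[symmetric]) simp
  finally show ?thesis .
qed


text \<open>The Cauchy-Schwarz inequality against a constant, from the nonnegativity of the variance.\<close>
lemma power2_sum_le_card_mult_sum_power2:
  fixes c :: "'a \<Rightarrow> int"
  shows "(sum c A)\<^sup>2 \<le> int (card A) * (\<Sum>z\<in>A. (c z)\<^sup>2)"
proof (cases "card A = 0")
  case True
  then show ?thesis by (cases "finite A") auto
next
  case False
  let ?n = "int (card A)" and ?S = "sum c A"
  have "0 \<le> (\<Sum>z\<in>A. (?n * c z - ?S)\<^sup>2)"
    by (intro sum_nonneg) simp
  also have "\<dots> = (\<Sum>z\<in>A. ?n\<^sup>2 * (c z)\<^sup>2 - 2 * ?n * ?S * c z + ?S\<^sup>2)"
    by (intro sum.cong) (auto simp: power2_eq_square algebra_simps)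
  also have "\<dots> = ?n\<^sup>2 * (\<Sum>z\<in>A. (c z)\<^sup>2) - 2 * ?n * ?S * ?S + ?n * ?S\<^sup>2"
    by (simp add: sum.distrib sum_subtractf sum_distrib_left)
  also have "\<dots> = ?n * (?n * (\<Sum>z\<in>A. (c z)\<^sup>2) - ?S\<^sup>2)"
    by (simp add: power2_eq_square algebra_simps)
  finally show ?thesis using False by (simp add: zero_le_mult_iff)
qed

section \<open>Codegrees into a vertex set of a conference graph\<close>

text \<open>
  The graph is given by its neighbourhoods, because every count below is the size of an
  intersection of neighbourhoods with some vertex set.
\<close>
locale conference_graph =
  fixes V :: "'a set" and N :: "'a \<Rightarrow> 'a set" and \<gamma> :: nat
  assumes finite_V: "finite V"
    and \<gamma>_ge_2: "\<gamma> \<ge> 2"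
    and N_subset: "N u \<subseteq> V"
    and N_sym: "v \<in> N u \<longleftrightarrow> u \<in> N v"
    and N_irrefl: "u \<notin> N u"
    and card_V: "card V = 4 * \<gamma> + 1"
    and card_N: "u \<in> V \<Longrightarrow> card (N u) = 2 * \<gamma>"
    and card_common_adj: "u \<in> V \<Longrightarrow> v \<in> N u \<Longrightarrow> card (N u \<inter> N v) = \<gamma> - 1"
    and card_common_nonadj: "u \<in> V \<Longrightarrow> v \<in> V \<Longrightarrow> u \<noteq> v \<Longrightarrow> v \<notin> N u \<Longrightarrow> card (N u \<inter> N v) = \<gamma>"
begin

lemma finite_N: "finite (N u)"
  using N_subset finite_V finite_subset by blast

lemma sum_codegree:
  assumes "finite A" "finite X"
  shows "(\<Sum>z\<in>A. int (card (N z \<inter> X))) = (\<Sum>u\<in>X. int (card (N u \<inter> A)))"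
proof -
  have card_eq: "int (card (N z \<inter> B)) = (\<Sum>u\<in>B. of_bool (u \<in> N z))" if "finite B" for z B
    using that by (simp add: of_bool_def sum.If_cases Int_def conj_commute)
  have "(\<Sum>z\<in>A. int (card (N z \<inter> X))) = (\<Sum>z\<in>A. \<Sum>u\<in>X. of_bool (u \<in> N z))"
    using assms by (simp add: card_eq)
  also have "\<dots> = (\<Sum>u\<in>X. \<Sum>z\<in>A. of_bool (z \<in> N u))"
    by (subst sum.swap) (simp add: N_sym)
  finally show ?thesis using assms by (simp add: card_eq)
qed

text \<open>
  The square counts the paths of length two with both ends in \<open>X\<close>, sorted by their middle vertex.
  Sorted by their ends, there are \<open>2 * \<gamma>\<close> of them when the ends coincide, and otherwise \<open>\<gamma>\<close>, minus
  one when the ends are adjacent.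
\<close>
lemma sum_power2_codegree:
  assumes "X \<subseteq> V"
  shows "(\<Sum>z\<in>V. (int (card (N z \<inter> X)))\<^sup>2) =
    int \<gamma> * int (card X) + int \<gamma> * (int (card X))\<^sup>2 - (\<Sum>u\<in>X. int (card (N u \<inter> X)))"
proof -
  have finX: "finite X" using assms finite_V finite_subset by blast
  have "(\<Sum>z\<in>V. (int (card (N z \<inter> X)))\<^sup>2) = (\<Sum>z\<in>V. \<Sum>v\<in>X. of_bool (v \<in> N z) * int (card (N z \<inter> X)))"
    using finX
    by (intro sum.cong) (auto simp: power2_eq_square sum_distrib_right[symmetric] of_bool_def
          sum.If_cases Int_def conj_commute)
  also have "\<dots> = (\<Sum>v\<in>X. \<Sum>z\<in>V. of_bool (v \<in> N z) * int (card (N z \<inter> X)))"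
    by (rule sum.swap)
  also have "\<dots> = (\<Sum>v\<in>X. \<Sum>z\<in>N v. int (card (N z \<inter> X)))"
  proof (rule sum.cong[OF refl])
    fix v
    have "(\<Sum>z\<in>V. of_bool (v \<in> N z) * int (card (N z \<inter> X)))
        = (\<Sum>z\<in>V. if z \<in> N v then int (card (N z \<inter> X)) else 0)"
      by (intro sum.cong) (auto simp: N_sym)
    also have "\<dots> = (\<Sum>z\<in>V \<inter> N v. int (card (N z \<inter> X)))"
      using finite_V by (simp add: sum.inter_restrict)
    finally show "(\<Sum>z\<in>V. of_bool (v \<in> N z) * int (card (N z \<inter> X))) = (\<Sum>z\<in>N v. int (card (N z \<inter> X)))"
      using N_subset[of v] by (simp add: Int_absorb1)
  qed
  also have "\<dots> = (\<Sum>v\<in>X. \<Sum>u\<in>X. int (card (N u \<inter> N v)))"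
    using finX finite_N by (simp add: sum_codegree)
  also have "\<dots> = (\<Sum>v\<in>X. int \<gamma> + int \<gamma> * int (card X) - int (card (N v \<inter> X)))"
  proof (rule sum.cong[OF refl])
    fix v assume v: "v \<in> X"
    have entry: "int (card (N u \<inter> N v)) = int \<gamma> + (if u = v then int \<gamma> else 0) - of_bool (u \<in> N v)"
      if "u \<in> X" for u
      using v that assms \<gamma>_ge_2 card_N[of u] card_common_adj[of u v] card_common_nonadj[of u v]
        N_irrefl[of u] N_sym[of u v]
      by (cases "u = v"; cases "u \<in> N v") (auto simp: of_nat_diff)
    have "(\<Sum>u\<in>X. int (card (N u \<inter> N v)))
        = (\<Sum>u\<in>X. int \<gamma> + (if u = v then int \<gamma> else 0) - of_bool (u \<in> N v))"
      by (intro sum.cong refl entry)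
    also have "\<dots> = int \<gamma> * int (card X) + int \<gamma> - int (card (N v \<inter> X))"
      using finX v
      by (simp add: sum.distrib sum_subtractf of_bool_def sum.If_cases Int_def conj_commute)
    finally show "(\<Sum>u\<in>X. int (card (N u \<inter> N v))) = int \<gamma> + int \<gamma> * int (card X) - int (card (N v \<inter> X))"
      by simp
  qed
  also have "\<dots> = int \<gamma> * int (card X) + int \<gamma> * (int (card X))\<^sup>2 - (\<Sum>u\<in>X. int (card (N u \<inter> X)))"
    by (simp add: sum.distrib sum_subtractf power2_eq_square algebra_simps)
  finally show ?thesis .
qed

end

section \<open>The partition of the vertices by an edge\<close>

locale conference_edge = conference_graph +
  fixes x y
  assumes x_V: "x \<in> V" and y_N_x: "y \<in> N x"
begin

definition D where "D = N x \<inter> N y"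
definition P where "P = N x - N y - {y}"
definition Q where "Q = N y - N x - {x}"
definition R where "R = V - (N x \<union> N y)"

lemmas part_defs = D_def P_def Q_def R_def

lemma y_V: "y \<in> V" using y_N_x N_subset by blast
lemma x_N_y: "x \<in> N y" using y_N_x N_sym by blast

lemma finite_parts: "finite D" "finite P" "finite Q" "finite R"
  using finite_N finite_V by (auto simp: part_defs)

lemma parts_subset: "D \<subseteq> V" "P \<subseteq> V" "Q \<subseteq> V" "R \<subseteq> V"
  using N_subset by (auto simp: part_defs)

lemma card_Int_N_x: "card (S \<inter> N x) = of_bool (y \<in> S) + card (S \<inter> D) + card (S \<inter> P)"
proof -
  have "S \<inter> N x = (S \<inter> {y}) \<union> ((S \<inter> D) \<union> (S \<inter> P))"
    using y_N_x by (auto simp: part_defs)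
  also have "card \<dots> = card (S \<inter> {y}) + (card (S \<inter> D) + card (S \<inter> P))"
    using finite_parts N_irrefl by (subst card_Un_disjoint card_Un_disjoint, auto simp: part_defs)+
  finally show ?thesis by simp
qed

lemma card_Int_N_y: "card (S \<inter> N y) = of_bool (x \<in> S) + card (S \<inter> D) + card (S \<inter> Q)"
proof -
  have "S \<inter> N y = (S \<inter> {x}) \<union> ((S \<inter> D) \<union> (S \<inter> Q))"
    using x_N_y by (auto simp: part_defs)
  also have "card \<dots> = card (S \<inter> {x}) + (card (S \<inter> D) + card (S \<inter> Q))"
    using finite_parts N_irrefl by (subst card_Un_disjoint card_Un_disjoint, auto simp: part_defs)+
  finally show ?thesis by simp
qed

lemma card_split:
  assumes "S \<subseteq> V"
  shows "card S = card (S \<inter> N x) + of_bool (x \<in> S) + card (S \<inter> Q) + card (S \<inter> R)"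
proof -
  have "S = (S \<inter> N x) \<union> ((S \<inter> {x}) \<union> ((S \<inter> Q) \<union> (S \<inter> R)))"
    using assms by (auto simp: part_defs)
  also have "card \<dots> = card (S \<inter> N x) + (card (S \<inter> {x}) + (card (S \<inter> Q) + card (S \<inter> R)))"
    using finite_parts finite_N N_irrefl x_N_y by (subst card_Un_disjoint card_Un_disjoint card_Un_disjoint, auto simp: part_defs)+
  finally show ?thesis by simp
qed

lemma card_D: "card D = \<gamma> - 1"
  using card_common_adj[OF x_V y_N_x] by (simp add: D_def)


lemma card_P: "card P = \<gamma>"
proof -
  have "N x \<inter> D = D" "N x \<inter> P = P" by (auto simp: part_defs)
  then show ?thesis
    using card_Int_N_x[of "N x"] y_N_x card_N[OF x_V] card_D \<gamma>_ge_2 by simp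
qed

lemma card_Q: "card Q = \<gamma>"
proof -
  have "N y \<inter> D = D" "N y \<inter> Q = Q" by (auto simp: part_defs)
  then show ?thesis
    using card_Int_N_y[of "N y"] x_N_y card_N[OF y_V] card_D \<gamma>_ge_2 by simp
qed

lemma card_R: "card R = \<gamma>"
proof -
  have "V \<inter> N x = N x" "V \<inter> Q = Q" "V \<inter> R = R" using N_subset by (auto simp: part_defs)
  then show ?thesis
    using card_split[of V] x_V card_V card_N[OF x_V] card_Q by simp
qed

text \<open>
  Three linear equations: the degree of \<open>u\<close>, its codegree with the neighbour \<open>x\<close>, and its codegree
  with the nonneighbour \<open>y\<close>. They leave the number of neighbours in \<open>Q\<close> as the only free parameter.
\<close>
lemma degrees_P:
  assumes "u \<in> P"
  shows "card (N u \<inter> P) = card (N u \<inter> Q)"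
    and "card (N u \<inter> D) + card (N u \<inter> Q) + 1 = \<gamma>"
    and "card (N u \<inter> R) + card (N u \<inter> Q) = \<gamma>"
proof -
  have u: "u \<in> V" "x \<in> N u" "y \<notin> N u" "u \<noteq> y"
    using assms parts_subset N_sym by (auto simp: part_defs)
  have "card (N u \<inter> D) + card (N u \<inter> P) = \<gamma> - 1"
    using card_Int_N_x[of "N u"] u card_common_adj[of u x] by simp
  moreover have "1 + card (N u \<inter> D) + card (N u \<inter> Q) = \<gamma>"
    using card_Int_N_y[of "N u"] u y_V card_common_nonadj[of u y] by simp
  moreover have "1 + card (N u \<inter> D) + card (N u \<inter> P) + card (N u \<inter> Q) + card (N u \<inter> R) = 2 * \<gamma>"
    using card_split[OF N_subset, of u] card_Int_N_x[of "N u"] u card_N[of u] by simp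
  ultimately show "card (N u \<inter> P) = card (N u \<inter> Q)"
    "card (N u \<inter> D) + card (N u \<inter> Q) + 1 = \<gamma>"
    "card (N u \<inter> R) + card (N u \<inter> Q) = \<gamma>"
    by linarith+
qed

text \<open>
  Reversing the edge exchanges \<open>P\<close> and \<open>Q\<close>, so that every statement about \<open>P\<close> yields its mirror
  image about \<open>Q\<close>.
\<close>
lemma reversed_edge: "conference_edge V N \<gamma> y x"
  by unfold_locales (fact y_V x_N_y)+

lemma reversed_parts:
  "conference_edge.D N y x = D" "conference_edge.P N y x = Q" "conference_edge.Q N y x = P"
  "conference_edge.R V N y x = R"
  using conference_edge.part_defs[OF reversed_edge] by (auto simp: part_defs)

lemmas degrees_Q = conference_edge.degrees_P[OF reversed_edge, unfolded reversed_parts]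

section \<open>The perfect matching between the private neighbours\<close>

text \<open>
  The neighbourhood of \<open>u\<close> is \<open>{x} \<union> D \<union> R\<close>, so the codegree of a vertex \<open>z\<close> with \<open>u\<close> gives a fourth
  linear equation for the numbers of neighbours of \<open>z\<close> in the four classes. These numbers are then
  determined, and being integers they fix the parity of \<open>\<gamma>\<close>: odd for \<open>z \<in> Q\<close> and even for
  \<open>z \<in> P\<close>.
\<close>
lemma no_isolated_in_P:
  assumes u: "u \<in> P" and iso: "N u \<inter> Q = {}"
  shows False
proof -
  have uV: "u \<in> V" using u parts_subset by blast
  have "N u \<inter> P = {}"
    using degrees_P(1)[OF u] iso finite_parts by auto
  have "card (N u \<inter> D) = card D" "card (N u \<inter> R) = card R"
    using degrees_P(2,3)[OF u] iso card_D card_R \<gamma>_ge_2 by simp_all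
  then have "N u \<inter> D = D" "N u \<inter> R = R"
    using finite_parts by (meson card_subset_eq inf_le2)+
  have N_u: "card (S \<inter> N u) = of_bool (x \<in> S) + card (S \<inter> D) + card (S \<inter> R)" for S
  proof -
    have "S \<inter> N u = (S \<inter> {x}) \<union> ((S \<inter> D) \<union> (S \<inter> R))"
      using \<open>N u \<inter> P = {}\<close> iso \<open>N u \<inter> D = D\<close> \<open>N u \<inter> R = R\<close> u N_subset[of u] N_sym
      by (auto simp: part_defs)
    also have "card \<dots> = card (S \<inter> {x}) + (card (S \<inter> D) + card (S \<inter> R))"
      using finite_parts N_irrefl x_N_y by (subst card_Un_disjoint card_Un_disjoint, auto simp: part_defs)+
    finally show ?thesis by simp
  qed
  have "Q \<noteq> {}" using card_Q \<gamma>_ge_2 by auto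
  then obtain z where z: "z \<in> Q" by blast
  have zu: "z \<in> V" "z \<noteq> u" "u \<notin> N z" "x \<notin> N z"
    using z u iso parts_subset N_sym by (auto simp: part_defs)
  have "card (N z \<inter> D) + card (N z \<inter> R) = \<gamma>"
    using N_u[of "N z"] card_common_nonadj[of z u] zu uV by simp
  then have odd: "2 * card (N z \<inter> D) + 1 = \<gamma>"
    using degrees_Q[OF z] by linarith
  have "P \<noteq> {u}" using card_P \<gamma>_ge_2 by auto
  then obtain w where w: "w \<in> P" "w \<noteq> u" using u by blast
  have wu: "w \<in> V" "u \<notin> N w" "x \<in> N w"
    using w u \<open>N u \<inter> P = {}\<close> parts_subset N_sym by (auto simp: part_defs)
  have "1 + card (N w \<inter> D) + card (N w \<inter> R) = \<gamma>"
    using N_u[of "N w"] card_common_nonadj[of w u] wu w uV by simp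
  then have "2 * card (N w \<inter> D) + 2 = \<gamma>"
    using degrees_P[OF w(1)] by linarith
  with odd show False by presburger
qed

text \<open>
  Clearing denominators in the four Cauchy-Schwarz bounds leaves \<open>(g - 1) * E + (s - 1) * K\<^sup>2 \<le> 0\<close>
  for a quadratic polynomial \<open>E\<close> in \<open>K\<close>. Its discriminant is a negative multiple of \<open>g - s - 3\<close>, so
  \<open>E\<close> is nonnegative as soon as \<open>g \<ge> s + 3\<close>. The extra term in \<open>K\<^sup>2\<close>, which stems from
  \<open>D\<close> having \<open>g - 1\<close> rather than \<open>g\<close> vertices, settles the case of equality: it forces \<open>K = 0\<close>, where \<open>E\<close> is
  positive.
\<close>
lemma cauchy_contradiction:
  fixes K s g :: int and SW SP SD SR :: int
  assumes s: "s \<ge> 3" and g: "g \<ge> s + 3"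
    and W: "K\<^sup>2 \<le> (s - 1) * SW" and P: "K\<^sup>2 \<le> g * SP"
    and D: "((g - 1) * s - K)\<^sup>2 \<le> (g - 1) * SD" and R: "(g * s - K)\<^sup>2 \<le> g * SR"
    and total: "s\<^sup>2 + SW + SP + SD + SR \<le> g * s + g * s\<^sup>2"
  shows False
proof -
  define p h E where "p = s - 1" and "h = g - 1" and "E = K\<^sup>2 * (g + 3 * p) - 4 * K * s * p * g + g\<^sup>2 * s * p\<^sup>2"
  have pos: "p > 0" "h > 0" "g > 0" "s > 0" using s g by (auto simp: p_def h_def E_def)
  have "p * g * h * s\<^sup>2 + g * h * K\<^sup>2 + p * h * K\<^sup>2 + p * g * (h * s - K)\<^sup>2 + p * h * (g * s - K)\<^sup>2
      \<le> p * g * h * s\<^sup>2 + g * h * (p * SW) + p * h * (g * SP) + p * g * (h * SD) + p * h * (g * SR)"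
    using W P D R pos by (intro add_mono mult_left_mono) (auto simp: p_def h_def E_def)
  also have "\<dots> = p * g * h * (s\<^sup>2 + SW + SP + SD + SR)"
    by (simp add: algebra_simps)
  also have "\<dots> \<le> p * g * h * (g * s + g * s\<^sup>2)"
    using total pos by (intro mult_left_mono) auto
  finally have "h * E + p * K\<^sup>2 \<le> 0"
    by (simp add: p_def h_def E_def power2_eq_square algebra_simps)
  moreover have "E \<ge> 0"
  proof -
    \<comment> \<open>completing the square in \<open>K\<close>\<close>
    have "4 * (g + 3 * p) * E = (2 * (g + 3 * p) * K - 4 * s * p * g)\<^sup>2 + 4 * g\<^sup>2 * s * p\<^sup>2 * (g - s - 3)"
      by (simp add: p_def h_def E_def power2_eq_square algebra_simps)
    also have "\<dots> \<ge> 0" using pos g by simp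
    finally show ?thesis using pos by (simp add: zero_le_mult_iff)
  qed
  ultimately have "p * K\<^sup>2 \<le> 0" "h * E \<le> 0"
    using pos by (smt (verit) mult_nonneg_nonneg zero_le_power2)+
  then have "K = 0" "E \<le> 0" using pos by (auto simp: mult_le_0_iff)
  then have "g\<^sup>2 * s * p\<^sup>2 \<le> 0" by (simp add: p_def h_def E_def)
  then show False using pos by (simp add: mult_le_0_iff)
qed

text \<open>
  Once \<open>card X \<ge> 4\<close>, the bound \<open>2 * card X \<le> \<gamma> + 1\<close> implies \<open>\<gamma> \<ge> card X + 3\<close>, which is what the
  Cauchy-Schwarz bound requires. For \<open>card X = 3\<close> it implies the same with the single exception
  \<open>\<gamma> = 5\<close>.
\<close>
lemma no_hall_violator:
  assumes X: "X \<subseteq> P" "X \<noteq> {}" "2 * card X \<le> \<gamma> + 1"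
    and small: "card (\<Union>u\<in>X. N u \<inter> Q) < card X"
  shows False
proof -
  define W where "W = (\<Union>u\<in>X. N u \<inter> Q)"
  define c where "c z = int (card (N z \<inter> X))" for z
  define s g K where "s = int (card X)" and "g = int \<gamma>" and "K = (\<Sum>u\<in>X. int (card (N u \<inter> Q)))"
  define e where "e = (\<Sum>u\<in>X. int (card (N u \<inter> X)))"
  let ?S = "\<lambda>A. \<Sum>z\<in>A. (c z)\<^sup>2"
  have finX: "finite X" using X(1) finite_parts finite_subset by blast
  have finW: "finite W" and WQ: "W \<subseteq> Q" using finX finite_parts by (auto simp: W_def)
  have XV: "X \<subseteq> V" using X(1) parts_subset by blast
  have c_sum: "sum c A = (\<Sum>u\<in>X. int (card (N u \<inter> A)))" if "finite A" for A
    unfolding c_def using that finX by (rule sum_codegree)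
  have "sum c W = (\<Sum>u\<in>X. int (card (N u \<inter> Q)))"
    unfolding c_sum[OF finW] by (intro sum.cong refl arg_cong[of _ _ "\<lambda>A. int (card A)"]) (auto simp: W_def)
  then have cW: "sum c W = K" by (simp add: K_def)
  have "sum c P = (\<Sum>u\<in>X. int (card (N u \<inter> Q)))"
    unfolding c_sum[OF finite_parts(2)] using X(1) degrees_P(1) by (intro sum.cong) auto
  then have cP: "sum c P = K" by (simp add: K_def)
  have "sum c D = (\<Sum>u\<in>X. g - 1 - int (card (N u \<inter> Q)))"
    unfolding c_sum[OF finite_parts(1)] g_def using X(1) by (intro sum.cong) (auto dest!: subsetD degrees_P(2))
  then have cD: "sum c D = (g - 1) * s - K"
    by (simp add: sum_subtractf s_def K_def)
  have "sum c R = (\<Sum>u\<in>X. g - int (card (N u \<inter> Q)))"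
    unfolding c_sum[OF finite_parts(4)] g_def using X(1) by (intro sum.cong) (auto dest!: subsetD degrees_P(3))
  then have cR: "sum c R = g * s - K"
    by (simp add: sum_subtractf s_def K_def)
  have cX: "sum c X = e" by (simp add: c_def e_def)
  have cPX: "sum c (P - X) = K - e"
    using sum.subset_diff[OF X(1) finite_parts(2), of c] cP cX by simp
  have SP: "?S P = ?S X + ?S (P - X)"
    using sum.subset_diff[OF X(1) finite_parts(2), of "\<lambda>z. (c z)\<^sup>2"] by simp
  have c_x: "c x = s"
  proof -
    have "N x \<inter> X = X" using X(1) by (auto simp: P_def)
    then show ?thesis by (simp add: c_def s_def g_def K_def)
  qed
  have e_nonneg: "e \<ge> 0" by (auto simp: e_def intro: sum_nonneg)
  have "s\<^sup>2 + ?S W + ?S P + ?S D + ?S R = ?S ({x} \<union> (W \<union> (P \<union> (D \<union> R))))"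
    using finite_parts finW WQ N_irrefl x_N_y c_x
    by (subst sum.union_disjoint sum.union_disjoint sum.union_disjoint sum.union_disjoint,
        auto simp: part_defs)+
  also have "\<dots> \<le> ?S V"
    using finite_V parts_subset WQ x_V by (intro sum_mono2) auto
  also have "\<dots> = g * s + g * s\<^sup>2 - e"
    using sum_power2_codegree[OF XV] by (simp add: c_def s_def g_def K_def e_def)
  finally have total: "s\<^sup>2 + ?S W + ?S P + ?S D + ?S R \<le> g * s + g * s\<^sup>2 - e" .
  have cards: "int (card W) \<le> s - 1" "int (card P) = g" "int (card D) = g - 1" "int (card R) = g"
      "int (card X) = s" "int (card (P - X)) = g - s"
    using small card_P card_D card_R \<gamma>_ge_2 X(1) finX card_mono[OF finite_parts(2) X(1)]
    by (auto simp: s_def g_def K_def W_def of_nat_diff card_Diff_subset)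
  have s_pos: "s \<ge> 1" using X(2) finX by (simp add: s_def g_def K_def Suc_le_eq card_gt_0_iff)
  have gs: "g \<ge> 2 * s - 1" using X(3) by (simp add: s_def g_def K_def)
  consider "s = 1" | "s = 2" | "s = 3" "g = 5" | "s \<ge> 3" "g \<ge> s + 3"
    using s_pos gs by linarith
  then show False
  proof cases
    case 1
    then obtain u where u: "X = {u}" using s_def by (auto simp: card_1_singleton_iff)
    then show False
      using no_isolated_in_P[of u] X(1) small finite_parts by simp
  next
    case 2
    \<comment> \<open>\<open>X\<close> has two vertices, so \<open>c\<close> takes only the values 0, 1, 2. The set \<open>W\<close> is at most a single vertex,
      and the mean of \<open>c\<close> on \<open>D\<close> and on \<open>R\<close> lies between 1 and 2: hence the chord through 1 and 2.
      Together these bounds give \<open>2 * g + e \<le> 2 * K + 2\<close>, so \<open>g = 3\<close>, \<open>K = 2\<close> and \<open>e = 0\<close>. In this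
      case the single vertex of \<open>P - X\<close> has \<open>c = 2\<close>, which the finer bound on \<open>P\<close> excludes.\<close>
    have "3 * K - 2 \<le> ?S W"
      using sum_power2_ge_chord[of 1 c W] cards cW 2 by simp
    moreover have "K \<le> ?S P"
      using sum_power2_ge_chord[of 0 c P] cP by simp
    moreover have "e + (3 * (K - e) - 2 * (g - 2)) \<le> ?S P"
      using sum_power2_ge_chord[of 0 c X] sum_power2_ge_chord[of 1 c "P - X"] cX cPX SP cards 2 by simp
    moreover have "3 * (2 * (g - 1) - K) - 2 * (g - 1) \<le> ?S D"
      using sum_power2_ge_chord[of 1 c D] cD cards 2 by simp
    moreover have "3 * (2 * g - K) - 2 * g \<le> ?S R"
      using sum_power2_ge_chord[of 1 c R] cR cards 2 by simp
    moreover have "K \<le> 2"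
    proof -
      have "card (N u \<inter> Q) \<le> 1" if "u \<in> X" for u
      proof -
        have "card (N u \<inter> Q) \<le> card W" using that finW by (intro card_mono) (auto simp: W_def)
        then show ?thesis using cards(1) 2 by simp
      qed
      then have "K \<le> (\<Sum>u\<in>X. 1)" unfolding s_def g_def K_def by (intro sum_mono) simp
      then show ?thesis using 2 cards(5) by simp
    qed
    ultimately show False using total 2 gs e_nonneg by simp
  next
    case 3
    \<comment> \<open>The first bounds on \<open>W\<close>, \<open>P\<close>, \<open>D\<close> and \<open>R\<close> add up to the admissible total whatever \<open>K\<close> is, so
      that \<open>e = 0\<close> and none of the four can be improved. But the second
      chord on \<open>D\<close> rules out \<open>K < 4\<close>, and for \<open>K \<ge> 4\<close> the splitting of \<open>P\<close> into \<open>X\<close>, where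
      \<open>c\<close> vanishes, and two further vertices does the rest.\<close>
    have "5 * K - 12 \<le> ?S W"
      using sum_power2_ge_chord[of 2 c W] cards cW 3 by simp
    moreover have "K \<le> ?S P"
      using sum_power2_ge_chord[of 0 c P] cP by simp
    moreover have "e + (5 * (K - e) - 12) \<le> ?S P"
      using sum_power2_ge_chord[of 0 c X] sum_power2_ge_chord[of 2 c "P - X"] cX cPX SP cards 3 by simp
    moreover have "3 * (12 - K) - 8 \<le> ?S D" "5 * (12 - K) - 24 \<le> ?S D"
      using sum_power2_ge_chord[of 1 c D] sum_power2_ge_chord[of 2 c D] cD cards 3 by simp_all
    moreover have "3 * (15 - K) - 10 \<le> ?S R"
      using sum_power2_ge_chord[of 1 c R] cR cards 3 by simp
    ultimately show False using total 3 e_nonneg by simp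
  next
    case 4
    have "K\<^sup>2 \<le> (s - 1) * ?S W"
    proof -
      have "K\<^sup>2 \<le> int (card W) * ?S W"
        using power2_sum_le_card_mult_sum_power2[of c W] cW by simp
      also have "\<dots> \<le> (s - 1) * ?S W"
        using cards(1) by (intro mult_right_mono sum_nonneg) auto
      finally show ?thesis .
    qed
    then show False
      using power2_sum_le_card_mult_sum_power2[of c P] power2_sum_le_card_mult_sum_power2[of c D]
        power2_sum_le_card_mult_sum_power2[of c R] cP cD cR cards total e_nonneg 4
      by (intro cauchy_contradiction[of s g K "?S W" "?S P" "?S D" "?S R"]) simp_all
  qed
qed

text \<open>
  A violator \<open>X\<close> of Hall's condition that is too large for the preceding lemma yields a small one
  for the reversed edge: the more than \<open>\<gamma> - card X\<close> vertices of \<open>Q\<close> without neighbours in \<open>X\<close>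
  have all their neighbours in the \<open>\<gamma> - card X\<close> vertices of \<open>P - X\<close>.
\<close>
lemma perfect_matching: "\<exists>f. bij_betw f P Q \<and> (\<forall>u \<in> P. f u \<in> N u)"
proof -
  have "\<exists>f. inj_on f P \<and> (\<forall>u \<in> P. f u \<in> N u \<inter> Q)"
  proof (rule hall_marriage)
    show "finite P" "finite (N u \<inter> Q)" for u using finite_parts by auto
    show "card X \<le> card (\<Union>u\<in>X. N u \<inter> Q)" if X: "X \<subseteq> P" for X
    proof (rule ccontr)
      let ?W = "\<Union>u\<in>X. N u \<inter> Q"
      assume "\<not> card X \<le> card ?W"
      then have less: "card ?W < card X" by simp
      then have "X \<noteq> {}" by auto
      then have "2 * card X > \<gamma> + 1"
        using no_hall_violator[OF X] less by fastforce
      have X_le: "card X \<le> \<gamma>" using card_mono[OF finite_parts(2) X] card_P by simp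
      have "?W \<subseteq> Q" by blast
      then have "card (Q - ?W) = \<gamma> - card ?W"
        using finite_parts card_Q by (simp add: card_Diff_subset finite_subset)
      then have "\<gamma> + 1 - card X \<le> card (Q - ?W)" using less by simp
      then obtain Y where Y: "Y \<subseteq> Q - ?W" "card Y = \<gamma> + 1 - card X"
        by (meson obtain_subset_with_card_n)
      have "(\<Union>v\<in>Y. N v \<inter> P) \<subseteq> P - X" using Y(1) N_sym by blast
      then have "card (\<Union>v\<in>Y. N v \<inter> P) \<le> card (P - X)"
        using finite_parts by (intro card_mono) auto
      also have "\<dots> = \<gamma> - card X"
        using X finite_parts card_P by (simp add: card_Diff_subset finite_subset)
      finally have "card (\<Union>v\<in>Y. N v \<inter> P) < card Y" using Y(2) X_le by simp
      moreover have "Y \<subseteq> Q" "Y \<noteq> {}" "2 * card Y \<le> \<gamma> + 1"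
        using Y X_le \<open>2 * card X > \<gamma> + 1\<close> by auto
      ultimately show False
        using conference_edge.no_hall_violator[OF reversed_edge, unfolded reversed_parts, of Y] by blast
    qed
  qed
  then obtain f where f: "inj_on f P" "\<forall>u \<in> P. f u \<in> N u \<inter> Q" by blast
  have "f ` P = Q"
    using f finite_parts card_P card_Q by (intro card_subset_eq) (auto simp: card_image)
  then show ?thesis using f by (auto simp: bij_betw_def)
qed

end


section \<open>Graph distance and transport cost\<close>

lemma (in fin_digraph) graph_dist_reachable:
  assumes "u \<rightarrow>\<^sup>* v"
  shows "\<exists>p. awalk u p v \<and> graph_dist G u v = real (length p)"
proof -
  have cost: "awalk_cost (\<lambda>_. 1) p = real (length p)" for p
    by (induction p) auto
  obtain p where "apath u p v" "\<mu> (\<lambda>_. 1) u v = awalk_cost (\<lambda>_. 1) p"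
    using min_cost_awalk[OF assms, of "\<lambda>_. 1"] by auto
  then show ?thesis by (auto simp: graph_dist_def cost apath_def)
qed

lemma (in fin_digraph) graph_dist_le:
  assumes "awalk u p v"
  shows "graph_dist G u v \<le> real (length p)"
proof -
  have cost: "awalk_cost (\<lambda>_. 1) p = real (length p)" for p
    by (induction p) auto
  have "u \<rightarrow>\<^sup>* v" using assms reachable_awalk by blast
  then obtain r where "\<mu> (\<lambda>_. 1) u v = awalk_cost (\<lambda>_. 1) r"
    using min_cost_awalk[of u v "\<lambda>_. 1"] by auto
  then show ?thesis
    using min_cost_le_walk_cost[OF assms, of "\<lambda>_. 1"] by (simp add: graph_dist_def cost)
qed

lemma (in fin_digraph) graph_dist_nonneg: "u \<rightarrow>\<^sup>* v \<Longrightarrow> 0 \<le> graph_dist G u v"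
  using graph_dist_reachable by force

lemma (in fin_digraph) graph_dist_ge_1:
  assumes "u \<rightarrow>\<^sup>* v" "u \<noteq> v"
  shows "1 \<le> graph_dist G u v"
proof -
  obtain p where p: "awalk u p v" "graph_dist G u v = real (length p)"
    using graph_dist_reachable[OF assms(1)] by blast
  then have "p \<noteq> []" using assms(2) by (auto simp: awalk_Nil_iff)
  then show ?thesis using p(2) by (cases p) auto
qed

lemma (in fin_digraph) graph_dist_self:
  assumes "u \<in> verts G"
  shows "graph_dist G u u = 0"
  using graph_dist_le[of u "[]" u] graph_dist_nonneg[of u u] assms by (simp add: awalk_Nil_iff)

lemma (in digraph) graph_dist_adj:
  assumes "u \<rightarrow> v"
  shows "graph_dist G u v = 1"
proof -
  obtain e where "e \<in> arcs G" "tail G e = u" "head G e = v" using assms by blast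
  then have "awalk u [e] v" using arc_implies_awalk by auto
  moreover have "u \<noteq> v" using assms adj_not_same by blast
  ultimately show ?thesis
    using graph_dist_le[of u "[e]" v] graph_dist_ge_1[of u v] assms by auto
qed

lemma (in nomulti_digraph) card_successors: "card {v. u \<rightarrow> v} = out_degree G u"
proof -
  have "{v. u \<rightarrow> v} = head G ` out_arcs G u"
    by (auto simp: arcs_ends_conv)
  moreover have "inj_on (head G) (out_arcs G u)"
    by (rule inj_onI) (auto intro!: no_multi_arcs simp: arc_to_ends_def)
  ultimately show ?thesis by (simp add: card_image out_degree_def)
qed

text \<open>
  The excess of the first measure over the second on \<open>A\<close> has to leave \<open>A\<close>, and it travels at least a
  unit distance. This is Kantorovich duality for the indicator of \<open>A\<close>, a function that is
  1-Lipschitz for a distance at least 1 off the diagonal.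
\<close>
lemma transport_cost_ge_excess:
  assumes "finite (verts G)" "transport_plan G \<mu>1 \<mu>2 \<pi>" "A \<subseteq> verts G"
    and "\<And>u v. u \<in> verts G \<Longrightarrow> v \<in> verts G \<Longrightarrow> of_bool (u \<noteq> v) \<le> graph_dist G u v"
  shows "sum \<mu>1 A - sum \<mu>2 A \<le> (\<Sum>w\<in>verts G. \<Sum>z\<in>verts G. graph_dist G z w * \<pi> z w)"
proof -
  let ?V = "verts G"
  have \<pi>: "0 \<le> \<pi> z w" if "z \<in> ?V" "w \<in> ?V" for z w
    using assms(2) that by (auto simp: transport_plan_def)
  have "sum \<mu>1 A = (\<Sum>z\<in>A. \<Sum>w\<in>?V. \<pi> z w)" "sum \<mu>2 A = (\<Sum>w\<in>A. \<Sum>z\<in>?V. \<pi> z w)"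
    using assms(2,3) by (auto simp: transport_plan_def intro!: sum.cong)
  moreover have "(\<Sum>z\<in>A. \<Sum>w\<in>?V. \<pi> z w) = (\<Sum>w\<in>?V. \<Sum>z\<in>?V. of_bool (z \<in> A) * \<pi> z w)"
    using assms(1,3) by (subst (2) sum.swap) (auto intro!: sum.mono_neutral_cong_left)
  moreover have "(\<Sum>w\<in>A. \<Sum>z\<in>?V. \<pi> z w) = (\<Sum>w\<in>?V. \<Sum>z\<in>?V. of_bool (w \<in> A) * \<pi> z w)"
    using assms(1,3) by (auto intro!: sum.mono_neutral_cong_left)
  ultimately have "sum \<mu>1 A - sum \<mu>2 A
      = (\<Sum>w\<in>?V. \<Sum>z\<in>?V. (of_bool (z \<in> A) - of_bool (w \<in> A)) * \<pi> z w)"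
    by (simp add: sum_subtractf left_diff_distrib)
  also have "\<dots> \<le> (\<Sum>w\<in>?V. \<Sum>z\<in>?V. graph_dist G z w * \<pi> z w)"
  proof (intro sum_mono mult_right_mono)
    fix z w assume zw: "w \<in> ?V" "z \<in> ?V"
    then show "of_bool (z \<in> A) - of_bool (w \<in> A) \<le> graph_dist G z w"
      using assms(4)[of z w] by (auto simp: of_bool_def split: if_splits)
  qed (auto intro: \<pi>)
  finally show ?thesis .
qed

text \<open>
  The plan that attains the lower bound spreads mass \<open>q\<close> over each vertex of the closed
  neighbourhood of \<open>x\<close> and moves it by the matching on \<open>P\<close>, leaving it in place elsewhere; the
  remaining mass \<open>p - q\<close> moves from \<open>x\<close> to \<open>y\<close>. This remainder is nonnegative by the hypothesis
  \<open>q \<le> p\<close>.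
\<close>
lemma wasserstein_lazy_measures_matching:
  fixes G :: "('a, 'b) pre_digraph" (structure)
  assumes "graph G"
    and conn: "\<And>u v. u \<in> verts G \<Longrightarrow> v \<in> verts G \<Longrightarrow> u \<rightarrow>\<^sup>* v"
    and xy: "x \<rightarrow> y"
    and deg: "out_degree G x = d" "out_degree G y = d"
    and f: "bij_betw f ({z. x \<rightarrow> z} - {z. y \<rightarrow> z} - {y}) ({z. y \<rightarrow> z} - {z. x \<rightarrow> z} - {x})"
    and f_adj: "\<And>z. z \<in> {z. x \<rightarrow> z} - {z. y \<rightarrow> z} - {y} \<Longrightarrow> z \<rightarrow> f z"
    and q: "q = (1 - p) / real d" "0 \<le> q" "q \<le> p" "p \<le> 1"
  shows "wasserstein G (lazy_measure G p x) (lazy_measure G p y)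
    = p - q + q * real (card ({z. x \<rightarrow> z} - {z. y \<rightarrow> z} - {y}))"
proof -
  interpret graph G by fact
  let ?V = "verts G"
  define P where "P = {z. x \<rightarrow> z} - {z. y \<rightarrow> z} - {y}"
  define Q where "Q = {z. y \<rightarrow> z} - {z. x \<rightarrow> z} - {x}"
  define S where "S = {z. x \<rightarrow> z \<and> y \<rightarrow> z} \<union> {x, y}"
  have yx: "y \<rightarrow> x" using xy arcs_ends_symmetric[OF sym_arcs] by blast
  have V: "x \<in> ?V" "y \<in> ?V" "x \<noteq> y" using xy adj_in_verts adj_not_same by blast+
  have Bx: "insert x {z. x \<rightarrow> z} = P \<union> S" and By: "insert y {z. y \<rightarrow> z} = Q \<union> S"
    using xy yx by (auto simp: P_def Q_def S_def)
  have subV: "P \<subseteq> ?V" "Q \<subseteq> ?V" "S \<subseteq> ?V"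
    using V by (auto simp: P_def Q_def S_def dest: adj_in_verts)
  have fin: "finite P" "finite Q" "finite S"
    using subV finite_verts finite_subset by blast+
  have disj: "P \<inter> S = {}" "Q \<inter> S = {}"
    using adj_not_same by (auto simp: P_def Q_def S_def)
  have xP: "x \<notin> P" "x \<in> S" "y \<in> S" using disj by (auto simp: S_def)
  define \<sigma> where "\<sigma> z = (if z \<in> P then f z else z)" for z
  have "bij_betw \<sigma> P Q"
    using f by (subst bij_betw_cong[of _ _ f]) (auto simp: \<sigma>_def P_def Q_def)
  moreover have "bij_betw \<sigma> S S"
    using disj by (subst bij_betw_cong[of _ _ id]) (auto simp: \<sigma>_def)
  ultimately have \<sigma>: "bij_betw \<sigma> (P \<union> S) (Q \<union> S)"
    using disj by (intro bij_betw_combine) auto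
  have lazy_x: "lazy_measure G p x z = q * of_bool (z \<in> P \<union> S) + (p - q) * of_bool (z = x)" for z
    using adj_not_same deg q(1) unfolding Bx[symmetric] by (auto simp: lazy_measure_def)
  have lazy_y: "lazy_measure G p y z = q * of_bool (z \<in> Q \<union> S) + (p - q) * of_bool (z = y)" for z
    using adj_not_same deg q(1) unfolding By[symmetric] by (auto simp: lazy_measure_def)
  define \<pi> where "\<pi> z w = q * of_bool (z \<in> P \<union> S \<and> w = \<sigma> z) + (p - q) * of_bool (z = x \<and> w = y)" for z w
  have \<sigma>V: "\<sigma> z \<in> ?V" if "z \<in> P \<union> S" for z
    using that \<sigma> subV by (auto dest!: bij_betw_apply[of \<sigma> _ _ z])
  have plan: "transport_plan G (lazy_measure G p x) (lazy_measure G p y) \<pi>"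
    unfolding transport_plan_def
  proof (intro conjI ballI)
    fix z w
    show "0 \<le> \<pi> z w" "\<pi> z w \<le> 1" using q(2-4) by (auto simp: \<pi>_def of_bool_def)
  next
    fix z assume z: "z \<in> ?V"
    have "(\<Sum>w\<in>?V. of_bool (z \<in> P \<union> S \<and> w = \<sigma> z)) = (of_bool (z \<in> P \<union> S) :: real)"
      using \<sigma>V[of z] by (cases "z \<in> P \<union> S") (auto simp: of_bool_def)
    moreover have "(\<Sum>w\<in>?V. of_bool (z = x \<and> w = y)) = (of_bool (z = x) :: real)"
      using V by (cases "z = x") (auto simp: of_bool_def)
    ultimately show "lazy_measure G p x z = (\<Sum>w\<in>?V. \<pi> z w)"
      by (simp add: lazy_x \<pi>_def sum.distrib sum_distrib_left[symmetric] del: sum_of_bool_eq)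
  next
    fix w assume w: "w \<in> ?V"
    have "(\<Sum>z\<in>?V. of_bool (z \<in> P \<union> S \<and> w = \<sigma> z)) = (\<Sum>z\<in>P \<union> S. of_bool (w = \<sigma> z) :: real)"
      using subV by (intro sum.mono_neutral_cong_right) auto
    also have "\<dots> = (\<Sum>v\<in>Q \<union> S. of_bool (w = v))"
      by (rule sum.reindex_bij_betw[OF \<sigma>])
    also have "\<dots> = of_bool (w \<in> Q \<union> S)"
      using fin by (simp add: of_bool_def)
    finally have "(\<Sum>z\<in>?V. of_bool (z \<in> P \<union> S \<and> w = \<sigma> z)) = (of_bool (w \<in> Q \<union> S) :: real)" .
    moreover have "(\<Sum>z\<in>?V. of_bool (z = x \<and> w = y)) = (of_bool (w = y) :: real)"
      using V by (cases "w = y") (auto simp: of_bool_def)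
    ultimately show "lazy_measure G p y w = (\<Sum>z\<in>?V. \<pi> z w)"
      by (simp add: lazy_y \<pi>_def sum.distrib sum_distrib_left[symmetric] del: sum_of_bool_eq)
  qed
  have "(\<Sum>w\<in>?V. \<Sum>z\<in>?V. graph_dist G z w * \<pi> z w)
      = (\<Sum>z\<in>?V. \<Sum>w\<in>?V. graph_dist G z w * \<pi> z w)"
    by (rule sum.swap)
  also have "\<dots> = (\<Sum>z\<in>?V. (if z \<in> P then q else 0) + (if z = x then p - q else 0))"
  proof (rule sum.cong[OF refl])
    fix z assume z: "z \<in> ?V"
    have "(\<Sum>w\<in>?V. graph_dist G z w * (q * of_bool (z \<in> P \<union> S \<and> w = \<sigma> z))) = (if z \<in> P then q else 0)"
    proof (cases "z \<in> P \<union> S")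
      case True
      have "(\<Sum>w\<in>?V. graph_dist G z w * (q * of_bool (z \<in> P \<union> S \<and> w = \<sigma> z)))
          = (\<Sum>w\<in>?V. if w = \<sigma> z then graph_dist G z w * q else 0)"
        using True by (intro sum.cong) auto
      also have "\<dots> = graph_dist G z (\<sigma> z) * q"
        using \<sigma>V[OF True] by simp
      also have "\<dots> = (if z \<in> P then q else 0)"
        using graph_dist_self[OF z] graph_dist_adj[OF f_adj[of z]] by (auto simp: \<sigma>_def P_def)
      finally show ?thesis .
    qed auto
    moreover have "(\<Sum>w\<in>?V. graph_dist G z w * ((p - q) * of_bool (z = x \<and> w = y))) = (if z = x then p - q else 0)"
    proof (cases "z = x")
      case True
      have "(\<Sum>w\<in>?V. graph_dist G z w * ((p - q) * of_bool (z = x \<and> w = y)))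
          = (\<Sum>w\<in>?V. if w = y then graph_dist G z w * (p - q) else 0)"
        using True by (intro sum.cong) auto
      then show ?thesis using True V graph_dist_adj[OF xy] by simp
    qed auto
    ultimately show "(\<Sum>w\<in>?V. graph_dist G z w * \<pi> z w) = (if z \<in> P then q else 0) + (if z = x then p - q else 0)"
      by (simp only: \<pi>_def distrib_left sum.distrib)
  qed
  also have "\<dots> = p - q + q * real (card P)"
    using V subV by (simp add: sum.distrib sum.If_cases Int_absorb1 mult.commute)
  finally have cost: "(\<Sum>w\<in>?V. \<Sum>z\<in>?V. graph_dist G z w * \<pi> z w) = p - q + q * real (card P)" .
  \<comment> \<open>the excess lives on \<open>insert x P\<close>\<close>
  have lower: "p - q + q * real (card P) \<le> (\<Sum>w\<in>?V. \<Sum>z\<in>?V. graph_dist G z w * \<rho> z w)"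
    if "transport_plan G (lazy_measure G p x) (lazy_measure G p y) \<rho>" for \<rho>
  proof -
    have "P \<inter> Q = {}" by (auto simp: P_def Q_def)
    then have "lazy_measure G p y z = 0" if "z \<in> P" for z
      using that disj xP by (auto simp: lazy_y)
    then have "sum (lazy_measure G p y) (insert x P) = q"
      using fin xP V by (simp add: lazy_y[of x])
    moreover have "sum (lazy_measure G p x) P = (\<Sum>z\<in>P. q)"
      using xP by (intro sum.cong) (auto simp: lazy_x)
    then have "sum (lazy_measure G p x) (insert x P) = p + q * real (card P)"
      using fin xP by (simp add: lazy_x)
    moreover have "of_bool (u \<noteq> v) \<le> graph_dist G u v" if "u \<in> ?V" "v \<in> ?V" for u v
      using graph_dist_ge_1 graph_dist_nonneg conn that by (cases "u = v") auto
    ultimately show ?thesis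
      using transport_cost_ge_excess[OF finite_verts that, of "insert x P"] V subV by simp
  qed
  show ?thesis
    unfolding wasserstein_def P_def[symmetric]
    by (rule cInf_eq_minimum) (use plan cost lower in \<open>auto intro!: image_eqI[of _ _ \<pi>]\<close>)
qed


section \<open>The curvature of conference graphs\<close>

lemma conference_graph_of_strongly_regular:
  fixes G :: "('a, 'b) pre_digraph" (structure)
  assumes "\<gamma> \<ge> 2" and srg: "strongly_regular G (4 * \<gamma> + 1) (2 * \<gamma>) (\<gamma> - 1) \<gamma>"
  shows "conference_graph (verts G) (\<lambda>u. {v. u \<rightarrow> v}) \<gamma>"
proof -
  interpret graph G using srg by (simp add: strongly_regular_def)
  have common: "{w. u \<rightarrow> w} \<inter> {w. v \<rightarrow> w} = common_neighbours G u v" for u v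
    by (auto simp: common_neighbours_def dest: adj_in_verts)
  show ?thesis
  proof
    show "v \<in> {w. u \<rightarrow> w} \<longleftrightarrow> u \<in> {w. v \<rightarrow> w}" for u v
      using arcs_ends_symmetric[OF sym_arcs] by blast
    show "card ({w. u \<rightarrow> w} \<inter> {w. v \<rightarrow> w}) = \<gamma> - 1"
      if "u \<in> verts G" "v \<in> {w. u \<rightarrow> w}" for u v
      using srg that adj_in_verts unfolding common strongly_regular_def by blast
    show "card ({w. u \<rightarrow> w} \<inter> {w. v \<rightarrow> w}) = \<gamma>"
      if "u \<in> verts G" "v \<in> verts G" "u \<noteq> v" "v \<notin> {w. u \<rightarrow> w}" for u v
      using srg that unfolding common strongly_regular_def by blast
  qed (use assms in \<open>auto simp: card_successors strongly_regular_def dest: adj_in_verts adj_not_same\<close>)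
qed

lemma strongly_regular_reachable:
  fixes G :: "('a, 'b) pre_digraph" (structure)
  assumes "strongly_regular G n d \<alpha> \<beta>" "\<beta> > 0" "u \<in> verts G" "v \<in> verts G"
  shows "u \<rightarrow>\<^sup>* v"
proof -
  interpret graph G using assms by (simp add: strongly_regular_def)
  have "\<exists>w. u \<rightarrow> w \<and> v \<rightarrow> w" if "u \<noteq> v" "\<not> u \<rightarrow> v"
  proof -
    have "card (common_neighbours G u v) = \<beta>"
      using assms that by (simp add: strongly_regular_def)
    then have "common_neighbours G u v \<noteq> {}" using assms(2) by auto
    then show ?thesis by (auto simp: common_neighbours_def)
  qed
  then show ?thesis
    using assms(3) arcs_ends_symmetric[OF sym_arcs] by (metis reachable_adjI reachable_refl reachable_trans)
qed

theorem theorem1p4: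
  fixes G :: "('a, 'b) pre_digraph" and \<gamma> :: nat
  assumes "\<gamma> \<ge> 2"
    and "strongly_regular G (4 * \<gamma> + 1) (2 * \<gamma>) (\<gamma> - 1) \<gamma>"
  shows "\<forall>x y. x \<rightarrow>\<^bsub>G\<^esub> y \<longrightarrow>
    ((\<lambda>p. ollivier_curvature G p x y / (1 - p)) \<longlongrightarrow> lly_curvature G x y) (at_left 1) \<and>
    lly_curvature G x y = 1 / 2 + 1 / (2 * real \<gamma>)"
proof (intro allI impI)
  fix x y assume xy: "x \<rightarrow>\<^bsub>G\<^esub> y"
  interpret graph G using assms(2) by (simp add: strongly_regular_def)
  interpret conference_edge "verts G" "\<lambda>u. {v. u \<rightarrow>\<^bsub>G\<^esub> v}" \<gamma> x y
    using conference_graph_of_strongly_regular[OF assms] xy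
    by (auto simp: conference_edge_def conference_edge_axioms_def adj_in_verts)
  obtain f where f: "bij_betw f P Q" "\<And>z. z \<in> P \<Longrightarrow> z \<rightarrow>\<^bsub>G\<^esub> f z"
    using perfect_matching by auto
  have deg: "out_degree G x = 2 * \<gamma>" "out_degree G y = 2 * \<gamma>"
    using assms(2) adj_in_verts[OF xy] by (auto simp: strongly_regular_def)
  let ?\<kappa> = "1 / 2 + 1 / (2 * real \<gamma>)"
  \<comment> \<open>For \<open>p\<close> near 1 the quotient is constant; \<open>p > 1 / 2\<close> is a simple way to have \<open>q \<le> p\<close>.\<close>
  have "ollivier_curvature G p x y / (1 - p) = ?\<kappa>" if p: "1 / 2 < p" "p < 1" for p
  proof -
    define q where "q = (1 - p) / real (2 * \<gamma>)"
    have q: "0 \<le> q" "q \<le> p"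
    proof -
      have "q \<le> (1 - p) / 1"
        unfolding q_def using p assms(1) by (intro divide_left_mono) auto
      then show "q \<le> p" using p by simp
    qed (use p in \<open>simp add: q_def\<close>)
    have "wasserstein G (lazy_measure G p x) (lazy_measure G p y) = p - q + q * real (card P)"
      unfolding P_def
      by (rule wasserstein_lazy_measures_matching[OF graph_axioms _ xy deg, where f = f])
        (use f q p strongly_regular_reachable[OF assms(2)] assms(1) in \<open>auto simp: P_def Q_def q_def\<close>)
    then have "ollivier_curvature G p x y = 1 - p + q - q * real \<gamma>"
      by (simp add: ollivier_curvature_def graph_dist_adj[OF xy] card_P)
    also have "\<dots> = (1 - p) * ?\<kappa>"
      using assms(1) by (simp add: q_def field_simps)
    finally show ?thesis using p by simp
  qed
  then have "eventually (\<lambda>p. ollivier_curvature G p x y / (1 - p) = ?\<kappa>) (at_left 1)"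
    using eventually_at_left_real[of "1/2" "1::real"] by (auto elim: eventually_mono)
  then have lim: "((\<lambda>p. ollivier_curvature G p x y / (1 - p)) \<longlongrightarrow> ?\<kappa>) (at_left 1)"
    by (rule tendsto_eventually)
  then have "lly_curvature G x y = ?\<kappa>"
    unfolding lly_curvature_def by (intro tendsto_Lim) simp_all
  with lim show "((\<lambda>p. ollivier_curvature G p x y / (1 - p)) \<longlongrightarrow> lly_curvature G x y) (at_left 1) \<and>
    lly_curvature G x y = ?\<kappa>"
    by simp
qed

end
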